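(* Let $H$ be a graph with $|E(H)|\ge 4$ and let $k,t$ be integers with $k=\binom{t}{2}\ge 6$. Then $$\operatorname{GM}_{k-2}(P_4:H)=\begin{cases}4, & t=4;\\ 12\binom{t}{4}-6(t-3), & t\ge 5.\end{cases}$$
   Context: All graphs are finite, simple and without isolated vertices. $P_n$ is the path on $n$ vertices. A $k$-edge-coloring of a graph is a map from its edge set onto $\{1,\dots,k\}$ that is exact, i.e. every one of the $k$ colors is used at least once. An edge-colored graph is rainbow if all its edges have distinct colors and monochromatic if all its edges have the same color. A copy of a graph $F$ in a graph $G$ is a subgraph of $G$ isomorphic to $F$; distinct copies are distinct subgraphs. For non-empty graphs $G,H$ and a positive integer $k$, the Gallai-Ramsey number $\operatorname{gr}_k(G:H)$ is the minimum integer $N$ such that for all $n\ge N$, every (exact) $k$-edge-coloring of $K_n$ contains a rainbow copy of $G$ or a monochromatic copy of $H$. The Gallai-Ramsey multiplicity $\operatorname{GM}_k(G:H)$ is the minimum, over all (exact) $k$-edge-colorings of $K_{\operatorname{gr}_k(G:H)}$, of the total number of rainbow copies of $G$ plus monochromatic copies of $H$.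
   Formalization: In the definition of the Gallai-Ramsey number, each n ≥ N is also required to admit an exact k-edge-coloring of K_n; read literally, small n satisfy the condition vacuously and the multiplicity would be a minimum over an empty set. *)

theory Defs
  imports Complex_Main
begin

text \<open>A graph is a pair of a vertex set and a set of edges, each edge being the
  two-element set of its ends.\<close>

type_synonym 'a graph = "'a set \<times> 'a set set"

abbreviation verts :: "'a graph \<Rightarrow> 'a set" where "verts \<equiv> fst"
abbreviation edges :: "'a graph \<Rightarrow> 'a set set" where "edges \<equiv> snd"

definition finite_simple_graph :: "'a graph \<Rightarrow> bool" where
  "finite_simple_graph G \<longleftrightarrow>
     finite (verts G) \<and> (\<forall>e \<in> edges G. e \<subseteq> verts G \<and> card e = 2)"

definition no_isolated_vertices :: "'a graph \<Rightarrow> bool" where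
  "no_isolated_vertices G \<longleftrightarrow> (\<forall>v \<in> verts G. \<exists>e \<in> edges G. v \<in> e)"

definition complete_graph :: "nat \<Rightarrow> nat graph" where
  "complete_graph n = ({..<n}, {e. e \<subseteq> {..<n} \<and> card e = 2})"

definition path_graph :: "nat \<Rightarrow> nat graph" where
  "path_graph n = ({..<n}, {{i, Suc i} | i. Suc i < n})"

definition subgraph :: "'a graph \<Rightarrow> 'a graph \<Rightarrow> bool" where
  "subgraph S G \<longleftrightarrow>
     finite_simple_graph S \<and> verts S \<subseteq> verts G \<and> edges S \<subseteq> edges G"

definition graph_isomorphic :: "'a graph \<Rightarrow> 'b graph \<Rightarrow> bool" where
  "graph_isomorphic F G \<longleftrightarrow>
     (\<exists>f. bij_betw f (verts F) (verts G) \<and> (\<lambda>e. f ` e) ` edges F = edges G)"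

definition copies :: "'a graph \<Rightarrow> 'b graph \<Rightarrow> 'b graph set" where
  "copies F G = {S. subgraph S G \<and> graph_isomorphic F S}"

text \<open>Colorings are total functions on vertex sets of which only the values on the
  edges of the graph matter.\<close>

definition exact_edge_coloring :: "'a graph \<Rightarrow> nat \<Rightarrow> ('a set \<Rightarrow> nat) \<Rightarrow> bool" where
  "exact_edge_coloring G k c \<longleftrightarrow> c ` edges G = {1..k}"

definition rainbow :: "('a set \<Rightarrow> nat) \<Rightarrow> 'a graph \<Rightarrow> bool" where
  "rainbow c S \<longleftrightarrow> inj_on c (edges S)"

definition monochromatic :: "('a set \<Rightarrow> nat) \<Rightarrow> 'a graph \<Rightarrow> bool" where
  "monochromatic c S \<longleftrightarrow> (\<exists>i. \<forall>e \<in> edges S. c e = i)"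

definition rainbow_copies :: "('b set \<Rightarrow> nat) \<Rightarrow> 'a graph \<Rightarrow> 'b graph \<Rightarrow> 'b graph set" where
  "rainbow_copies c F G = {S \<in> copies F G. rainbow c S}"

definition monochromatic_copies :: "('b set \<Rightarrow> nat) \<Rightarrow> 'a graph \<Rightarrow> 'b graph \<Rightarrow> 'b graph set" where
  "monochromatic_copies c F G = {S \<in> copies F G. monochromatic c S}"

text \<open>An exact \<open>k\<close>-edge-coloring of \<open>K\<^sub>n\<close> exists only if \<open>k \<le> n choose 2\<close>. The first
  conjunct below excludes those \<open>n\<close> for which the second one holds vacuously: otherwise
  the Gallai-Ramsey number could be an \<open>n\<close> for which \<open>K\<^sub>n\<close> has no exact coloring at all,
  and the multiplicity would be a minimum over the empty set.\<close>

definition gallai_ramsey :: "nat \<Rightarrow> 'a graph \<Rightarrow> 'b graph \<Rightarrow> nat" where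
  "gallai_ramsey k G H = (LEAST N. \<forall>n \<ge> N.
     (\<exists>c. exact_edge_coloring (complete_graph n) k c) \<and>
     (\<forall>c. exact_edge_coloring (complete_graph n) k c \<longrightarrow>
        rainbow_copies c G (complete_graph n) \<noteq> {} \<or>
        monochromatic_copies c H (complete_graph n) \<noteq> {}))"

definition gallai_ramsey_multiplicity :: "nat \<Rightarrow> 'a graph \<Rightarrow> 'b graph \<Rightarrow> nat" where
  "gallai_ramsey_multiplicity k G H =
     (let K = complete_graph (gallai_ramsey k G H) in
      LEAST m. \<exists>c. exact_edge_coloring K k c \<and>
        m = card (rainbow_copies c G K) + card (monochromatic_copies c H K))"

end

theory Submission
  imports Defs
begin

text \<open>
  A coloring of \<open>K\<^sub>n\<close> with at least four colors always has a rainbow \<open>P\<^sub>4\<close>, so the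
  Gallai-Ramsey number is the least \<open>n\<close> with enough edges, namely \<open>t\<close>. There only two
  edges repeat a color, hence either one color class has three edges or two classes have
  two edges each, all others being singletons; no monochromatic copy of \<open>H\<close> fits. A copy of
  \<open>P\<^sub>4\<close> fails to be rainbow iff it contains two edges of the same color, and a pair of edges
  lies in \<open>2 (t - 3)\<close> copies if the edges are adjacent and in \<open>4\<close> if they are disjoint. For
  \<open>t \<ge> 5\<close> three adjacent pairs are the worst case, realised by a monochromatic triangle;
  for \<open>t = 4\<close> it is two disjoint pairs, since among three edges of \<open>K\<^sub>4\<close> at most one pair
  is disjoint.
\<close>

section \<open>Copies of the path on four vertices in \<open>K_n\<close> and their number\<close>

definition path_on :: "'a \<Rightarrow> 'a \<Rightarrow> 'a \<Rightarrow> 'a \<Rightarrow> 'a graph" where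
  "path_on a b c d = ({a, b, c, d}, {{a, b}, {b, c}, {c, d}})"

lemma path_on_simps [simp]:
  "verts (path_on a b c d) = {a, b, c, d}"
  "edges (path_on a b c d) = {{a, b}, {b, c}, {c, d}}"
  by (simp_all add: path_on_def)

lemma path_on_rev: "path_on d c b a = path_on a b c d"
  by (auto simp: path_on_def insert_commute)

lemma edges_path_graph_4: "edges (path_graph 4) = {{0, 1}, {1, 2}, {2, 3}}"
proof -
  have "{{i, Suc i} | i. Suc i < 4} = (\<lambda>i. {i, Suc i}) ` {..<3}"
    by auto
  then show ?thesis
    by (simp add: path_graph_def lessThan_Suc numeral_3_eq_3 insert_commute numeral_2_eq_2)
qed

lemma verts_path_graph_4: "verts (path_graph 4) = {0, 1, 2, 3}"
  by (auto simp: path_graph_def)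

text \<open>All later counts are made on explicit vertex sequences. An isomorphism from
  \<open>path_graph 4\<close> is the list of its four values, and conversely indexing into such a
  list is an isomorphism.\<close>

lemma copies_path_4:
  "copies (path_graph 4) (complete_graph n) =
    {path_on a b c d | a b c d. distinct [a, b, c, d] \<and> {a, b, c, d} \<subseteq> {..<n}}" (is "?L = ?R")
proof (intro equalityI subsetI)
  fix S assume "S \<in> ?L"
  then obtain f where sub: "subgraph S (complete_graph n)"
    and bij: "bij_betw f (verts (path_graph 4)) (verts S)"
    and im: "(\<lambda>e. f ` e) ` edges (path_graph 4) = edges S"
    by (auto simp: copies_def graph_isomorphic_def)
  have "S = path_on (f 0) (f 1) (f 2) (f 3)"
    using bij im unfolding edges_path_graph_4 verts_path_graph_4
    by (intro prod_eqI) (auto simp: bij_betw_def)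
  moreover have "distinct [f 0, f 1, f 2, f 3]"
    using bij unfolding verts_path_graph_4 by (auto simp: bij_betw_def inj_on_def)
  moreover have "{f 0, f 1, f 2, f 3} \<subseteq> {..<n}"
    using sub bij unfolding verts_path_graph_4
    by (auto simp: bij_betw_def subgraph_def complete_graph_def)
  ultimately show "S \<in> ?R" by blast
next
  fix S assume "S \<in> ?R"
  then obtain a b c d where S: "S = path_on a b c d"
    and d: "distinct [a, b, c, d]" and n: "{a, b, c, d} \<subseteq> {..<n}" by blast
  let ?f = "(!) [a, b, c, d]"
  have "bij_betw ?f (verts (path_graph 4)) (verts S)"
    using d unfolding verts_path_graph_4 S
    by (auto simp: bij_betw_def inj_on_def numeral_2_eq_2 numeral_3_eq_3)
  moreover have "(\<lambda>e. ?f ` e) ` edges (path_graph 4) = edges S"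
    unfolding edges_path_graph_4 S by (simp add: numeral_2_eq_2 numeral_3_eq_3)
  moreover have "subgraph S (complete_graph n)"
    using d n by (auto simp: S subgraph_def finite_simple_graph_def complete_graph_def)
  ultimately show "S \<in> ?L" by (auto simp: copies_def graph_isomorphic_def)
qed

lemma finite_copies_path_4: "finite (copies (path_graph 4) (complete_graph n))"
proof -
  have "copies (path_graph 4) (complete_graph n) \<subseteq> Pow {..<n} \<times> Pow (Pow {..<n})"
    unfolding copies_path_4 by (auto simp: path_on_def)
  then show ?thesis by (rule finite_subset) auto
qed

text \<open>The middle edge is the only one that meets both others, so the edges determine the
  vertex sequence up to reversal.\<close>

lemma path_on_eq_iff:
  assumes "distinct [a, b, c, d]" "distinct [a', b', c', d']"
  shows "path_on a b c d = path_on a' b' c' d' \<longleftrightarrow>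
    [a, b, c, d] = [a', b', c', d'] \<or> [a, b, c, d] = [d', c', b', a']"
proof
  assume eq: "path_on a b c d = path_on a' b' c' d'"
  then have E: "{{a, b}, {b, c}, {c, d}} = {{a', b'}, {b', c'}, {c', d'}}"
    by (simp add: path_on_def)
  have "{a, b} \<in> {{a', b'}, {b', c'}, {c', d'}}" "{b, c} \<in> {{a', b'}, {b', c'}, {c', d'}}"
    "{c, d} \<in> {{a', b'}, {b', c'}, {c', d'}}"
    unfolding E[symmetric] by simp_all
  with assms show "[a, b, c, d] = [a', b', c', d'] \<or> [a, b, c, d] = [d', c', b', a']"
    by (auto simp: doubleton_eq_iff)
qed (auto simp: path_on_rev)

text \<open>Each copy comes from exactly two lists of distinct vertices, reverses of each other.
  \<open>A\<close> keeps the one whose first entry is smaller than its last, so the number of copies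
  is half of \<open>24 * (n choose 4)\<close>.\<close>

lemma card_copies_path_4:
  "card (copies (path_graph 4) (complete_graph n)) = 12 * (n choose 4)"
proof -
  define L where "L = {xs. length xs = 4 \<and> distinct xs \<and> set xs \<subseteq> {..<n}}"
  define A where "A = {xs \<in> L. xs ! 0 < xs ! 3}"
  define B where "B = {xs \<in> L. xs ! 3 < xs ! 0}"
  define g :: "nat list \<Rightarrow> nat graph" where
    "g xs = path_on (xs ! 0) (xs ! 1) (xs ! 2) (xs ! 3)" for xs
  have fin: "finite L"
    unfolding L_def by (rule finite_subset[OF _ finite_lists_length_eq[of "{..<n}" 4]]) auto
  have four: "\<exists>a b c d. xs = [a, b, c, d]" if "length xs = 4" for xs :: "nat list"
    using that by (auto simp: length_Suc_conv eval_nat_numeral)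
  have cases: "\<exists>a b c d. xs = [a, b, c, d] \<and> distinct [a, b, c, d] \<and> {a, b, c, d} \<subseteq> {..<n}"
    if "xs \<in> L" for xs
    using that four[of xs] unfolding L_def by force
  have memL: "[a, b, c, d] \<in> L \<longleftrightarrow> distinct [a, b, c, d] \<and> {a, b, c, d} \<subseteq> {..<n}" for a b c d
    by (auto simp: L_def)
  have g: "g [a, b, c, d] = path_on a b c d" for a b c d
    by (simp add: g_def numeral_2_eq_2 numeral_3_eq_3)
  have "L = A \<union> B"
    using cases unfolding A_def B_def by (fastforce simp: numeral_3_eq_3)
  moreover have "A \<inter> B = {}" by (auto simp: A_def B_def)
  moreover have "finite A" "finite B" using fin by (auto simp: A_def B_def)
  ultimately have LAB: "card L = card A + card B" by (simp add: card_Un_disjoint)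
  have "bij_betw rev A B"
  proof (rule bij_betw_byWitness[where f' = rev])
    show "rev ` A \<subseteq> B" "rev ` B \<subseteq> A"
      by (auto simp: A_def B_def L_def rev_nth)
  qed auto
  then have "card A = card B" by (rule bij_betw_same_card)
  moreover have "bij_betw g A (copies (path_graph 4) (complete_graph n))"
    unfolding bij_betw_def
  proof
    show "inj_on g A"
    proof (rule inj_onI)
      fix xs ys assume "xs \<in> A" "ys \<in> A" and eq: "g xs = g ys"
      moreover from this obtain a b c d a' b' c' d' where
        xs: "xs = [a, b, c, d]" and ys: "ys = [a', b', c', d']"
        using four[of xs] four[of ys] by (auto simp: A_def L_def)
      ultimately have d: "distinct [a, b, c, d]" "distinct [a', b', c', d']" and "a < d" "a' < d'"
        by (auto simp: A_def L_def)
      from eq have "xs = ys \<or> [a, b, c, d] = [d', c', b', a']"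
        unfolding xs ys g by (simp only: path_on_eq_iff[OF d])
      then show "xs = ys" using \<open>a < d\<close> \<open>a' < d'\<close> by auto
    qed
    show "g ` A = copies (path_graph 4) (complete_graph n)"
    proof (intro equalityI subsetI)
      fix S assume "S \<in> g ` A"
      then obtain xs where xs: "xs \<in> L" "S = g xs" by (auto simp: A_def)
      from cases[OF xs(1)] obtain a b c d where "xs = [a, b, c, d]"
        and d: "distinct [a, b, c, d]" "{a, b, c, d} \<subseteq> {..<n}" by blast
      then have "S = path_on a b c d" using xs(2) g by simp
      then show "S \<in> copies (path_graph 4) (complete_graph n)"
        unfolding copies_path_4 using d by blast
    next
      fix S assume "S \<in> copies (path_graph 4) (complete_graph n)"
      then obtain a b c d where S: "S = path_on a b c d"
        and d: "distinct [a, b, c, d]" "{a, b, c, d} \<subseteq> {..<n}"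
        unfolding copies_path_4 by blast
      show "S \<in> g ` A"
      proof (cases "a < d")
        case True
        then have "[a, b, c, d] \<in> A" using d memL by (simp add: A_def)
        then show ?thesis using S g by (metis imageI)
      next
        case False
        then have "[d, c, b, a] \<in> A" using d memL[of d c b a] by (auto simp: A_def)
        then show ?thesis using S g path_on_rev by (metis imageI)
      qed
    qed
  qed
  then have "card A = card (copies (path_graph 4) (complete_graph n))"
    by (rule bij_betw_same_card)
  moreover have "card L = 24 * (n choose 4)"
  proof (cases "4 \<le> n")
    case True
    then have "card L = \<Prod>{n - 4 + 1..n}"
      unfolding L_def by (subst card_lists_distinct_length_eq) auto
    \<comment> \<open>Both sides are multiplied by \<open>fact (n - 4)\<close>, which turns each
      into \<open>fact n\<close> and avoids division.\<close>
    also have "\<dots> = fact 4 * (n choose 4)"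
    proof -
      have "(\<Prod>{n - 4 + 1..n}) * fact (n - 4) = fact n"
        using True fact_div_fact[of "n - 4" n] fact_dvd[of "n - 4" n, where 'a = nat]
        by (metis Suc_eq_plus1 diff_le_self dvd_div_mult_self)
      moreover have "fact 4 * fact (n - 4) * (n choose 4) = fact n"
        using binomial_fact_lemma[OF True] .
      ultimately have "(\<Prod>{n - 4 + 1..n}) * fact (n - 4) = (fact 4 * (n choose 4)) * fact (n - 4)"
        by (simp add: mult_ac)
      then show ?thesis by simp
    qed
    also have "fact 4 = (24 :: nat)" by (simp add: eval_nat_numeral)
    finally show ?thesis .
  next
    case False
    have "L = {}"
    proof (rule ccontr)
      assume "L \<noteq> {}"
      then obtain xs where "length xs = 4" "distinct xs" "set xs \<subseteq> {..<n}" by (auto simp: L_def)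
      then show False using False card_mono[of "{..<n}" "set xs"] by (simp add: distinct_card)
    qed
    then show ?thesis using False by (simp add: binomial_eq_0)
  qed
  ultimately show ?thesis using LAB by simp
qed

lemma card_edges_copy_path_4:
  assumes "S \<in> copies (path_graph 4) (complete_graph n)"
  shows "card (edges S) = 3"
  using assms by (auto simp: copies_path_4 doubleton_eq_iff card_insert_if)

lemma card_Union_edges_copy_path_4:
  assumes "S \<in> copies (path_graph 4) (complete_graph n)"
  shows "card (\<Union> (edges S)) = 4"
proof -
  obtain a b c d where S: "S = path_on a b c d" and d: "distinct [a, b, c, d]"
    using assms unfolding copies_path_4 by blast
  have "\<Union> (edges S) = {a, b, c, d}" using S by auto
  then show ?thesis using d by simp
qed

section \<open>Copies of the path through two given edges\<close>

definition copies_through :: "nat \<Rightarrow> nat set \<Rightarrow> nat set \<Rightarrow> nat graph set" where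
  "copies_through n e f =
    {S \<in> copies (path_graph 4) (complete_graph n). e \<in> edges S \<and> f \<in> edges S}"

lemma finite_copies_through: "finite (copies_through n e f)"
  using finite_copies_path_4 by (simp add: copies_through_def)

text \<open>The two edges form the path \<open>x\<close>, \<open>y\<close>, \<open>z\<close>. A copy
  arises by attaching one of the \<open>n - 3\<close> remaining vertices at \<open>z\<close> or at
  \<open>x\<close>, and no copy arises twice.\<close>

lemma card_copies_through_adjacent:
  assumes "distinct [x, y, z]" "{x, y, z} \<subseteq> {..<n}"
  shows "card (copies_through n {x, y} {y, z}) = 2 * (n - 3)"
proof -
  let ?W = "{..<n} - {x, y, z}"
  have eq: "copies_through n {x, y} {y, z} = path_on x y z ` ?W \<union> (\<lambda>w. path_on w x y z) ` ?W"
    (is "?L = ?A \<union> ?B")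
  proof (intro equalityI subsetI)
    fix S assume "S \<in> ?L"
    then obtain a b c d where S: "S = path_on a b c d"
      and d: "distinct [a, b, c, d]" "{a, b, c, d} \<subseteq> {..<n}"
      and e: "{x, y} \<in> {{a, b}, {b, c}, {c, d}}" "{y, z} \<in> {{a, b}, {b, c}, {c, d}}"
      by (auto simp: copies_through_def copies_path_4)
    have "[x, y, z] = [a, b, c] \<or> [x, y, z] = [c, b, a] \<or> [x, y, z] = [b, c, d] \<or> [x, y, z] = [d, c, b]"
      using d e assms by (auto simp: doubleton_eq_iff)
    then show "S \<in> ?A \<union> ?B"
    proof (elim disjE)
      assume "[x, y, z] = [a, b, c]"
      then show ?thesis using S d by auto
    next
      assume "[x, y, z] = [c, b, a]"
      then show ?thesis using S d path_on_rev[of a b c d] by auto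
    next
      assume "[x, y, z] = [b, c, d]"
      then show ?thesis using S d by auto
    next
      assume "[x, y, z] = [d, c, b]"
      then show ?thesis using S d path_on_rev[of a b c d] by auto
    qed
  next
    fix S assume "S \<in> ?A \<union> ?B"
    then obtain w where w: "w \<in> ?W" and S: "S = path_on x y z w \<or> S = path_on w x y z" by blast
    then have "distinct [x, y, z, w]" "distinct [w, x, y, z]"
      "{x, y, z, w} \<subseteq> {..<n}" "{w, x, y, z} \<subseteq> {..<n}"
      using assms by auto
    with S have "S \<in> copies (path_graph 4) (complete_graph n)"
      unfolding copies_path_4 by blast
    then show "S \<in> ?L" using S by (auto simp: copies_through_def)
  qed
  have d: "distinct [x, y, z, w]" "distinct [w, x, y, z]" if "w \<in> ?W" for w
    using assms(1) that by auto
  have "path_on x y z w \<noteq> path_on w' x y z" if "w \<in> ?W" "w' \<in> ?W" for w w'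
    using assms(1) path_on_eq_iff[OF d(1)[OF that(1)] d(2)[OF that(2)]] by auto
  then have "?A \<inter> ?B = {}" by blast
  moreover have "inj_on (path_on x y z) ?W"
    by (rule inj_onI) (use assms(1) path_on_eq_iff[OF d(1) d(1)] in auto)
  moreover have "inj_on (\<lambda>w. path_on w x y z) ?W"
    by (rule inj_onI) (use assms(1) path_on_eq_iff[OF d(2) d(2)] in auto)
  moreover have "card ?W = n - 3"
    using assms by (simp add: card_Diff_subset)
  ultimately show ?thesis
    unfolding eq by (simp add: card_Un_disjoint card_image)
qed

text \<open>Disjoint edges can only be the two end edges of the path, so a copy is fixed by its
  middle edge, which joins one of \<open>x\<close>, \<open>y\<close> to one of \<open>u\<close>,
  \<open>v\<close>.\<close>

lemma card_copies_through_disjoint: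
  assumes "distinct [x, y, u, v]" "{x, y, u, v} \<subseteq> {..<n}"
  shows "card (copies_through n {x, y} {u, v}) = 4"
proof -
  have "copies_through n {x, y} {u, v} =
    {path_on x y u v, path_on x y v u, path_on y x u v, path_on y x v u}" (is "?L = ?R")
  proof (intro equalityI subsetI)
    fix S assume "S \<in> ?L"
    then obtain a b c d where S: "S = path_on a b c d"
      and d: "distinct [a, b, c, d]" "{a, b, c, d} \<subseteq> {..<n}"
      and e: "{x, y} \<in> {{a, b}, {b, c}, {c, d}}" "{u, v} \<in> {{a, b}, {b, c}, {c, d}}"
      by (auto simp: copies_through_def copies_path_4)
    have "{x, y} = {a, b} \<and> {u, v} = {c, d} \<or> {u, v} = {a, b} \<and> {x, y} = {c, d}"
      using d e assms by (auto simp: doubleton_eq_iff)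
    then show "S \<in> ?R"
      using S path_on_rev[of a b c d] by (auto simp: doubleton_eq_iff)
  next
    fix S assume S: "S \<in> ?R"
    have "S \<in> copies (path_graph 4) (complete_graph n)"
      unfolding copies_path_4 using S assms by fastforce
    then show "S \<in> ?L" using S by (auto simp: copies_through_def)
  qed
  then show ?thesis using assms by (simp add: path_on_eq_iff card_insert_if)
qed

lemma edges_complete_graph: "edges (complete_graph n) = {e. e \<subseteq> {..<n} \<and> card e = 2}"
  by (simp add: complete_graph_def)

lemma finite_edges_complete_graph: "finite (edges (complete_graph n))"
  unfolding edges_complete_graph by (rule finite_subset[of _ "Pow {..<n}"]) auto

lemma card_edges_complete_graph: "card (edges (complete_graph n)) = n choose 2"
  unfolding edges_complete_graph using n_subsets[of "{..<n}" 2] by simp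

lemma edge_complete_graph_iff: "{x, y} \<in> edges (complete_graph n) \<longleftrightarrow> x \<noteq> y \<and> x < n \<and> y < n"
  by (auto simp: edges_complete_graph card_insert_if)

lemma card_copies_through_meet:
  assumes "e \<in> edges (complete_graph n)" "f \<in> edges (complete_graph n)" "e \<noteq> f" "e \<inter> f \<noteq> {}"
  shows "card (copies_through n e f) = 2 * (n - 3)"
proof -
  obtain y where y: "y \<in> e" "y \<in> f" using assms(4) by blast
  from y assms(1) obtain x where x: "e = {x, y}" "x \<noteq> y"
    by (auto simp: edges_complete_graph card_2_iff doubleton_eq_iff)
  from y assms(2) obtain z where z: "f = {y, z}" "z \<noteq> y"
    by (auto simp: edges_complete_graph card_2_iff doubleton_eq_iff)
  show ?thesis unfolding x z
    by (rule card_copies_through_adjacent) (use assms x z in \<open>auto simp: edges_complete_graph\<close>)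
qed

lemma card_copies_through_disjnt:
  assumes "e \<in> edges (complete_graph n)" "f \<in> edges (complete_graph n)" "e \<inter> f = {}"
  shows "card (copies_through n e f) = 4"
proof -
  obtain x y where x: "e = {x, y}" "x \<noteq> y"
    using assms(1) by (auto simp: edges_complete_graph card_2_iff)
  obtain u v where u: "f = {u, v}" "u \<noteq> v"
    using assms(2) by (auto simp: edges_complete_graph card_2_iff)
  show ?thesis unfolding x u
    by (rule card_copies_through_disjoint) (use assms x u in \<open>auto simp: edges_complete_graph\<close>)
qed

section \<open>Non-rainbow copies, color classes and monochromatic copies\<close>

lemma card_rainbow_path_4:
  "card (rainbow_copies c (path_graph 4) (complete_graph n)) =
    12 * (n choose 4) - card {S \<in> copies (path_graph 4) (complete_graph n). \<not> rainbow c S}"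
proof -
  let ?K = "copies (path_graph 4) (complete_graph n)"
  have "rainbow_copies c (path_graph 4) (complete_graph n) = ?K - {S \<in> ?K. \<not> rainbow c S}"
    by (auto simp: rainbow_copies_def)
  then show ?thesis
    using finite_copies_path_4[of n] card_copies_path_4[of n] by (simp add: card_Diff_subset)
qed

lemma edges_copy: "S \<in> copies F G \<Longrightarrow> edges S \<subseteq> edges G"
  by (auto simp: copies_def subgraph_def)

text \<open>A non-rainbow copy has two edges of equal color, so it lies in the family
  \<open>copies_through n e f\<close> of such a pair. Upper bounds thus reduce to locating the pairs
  of equal color.\<close>

lemma not_rainbow_subset:
  assumes "\<And>e f. \<lbrakk>e \<in> edges (complete_graph n); f \<in> edges (complete_graph n); e \<noteq> f; c e = c f\<rbrakk>
    \<Longrightarrow> copies_through n e f \<subseteq> X"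
  shows "{S \<in> copies (path_graph 4) (complete_graph n). \<not> rainbow c S} \<subseteq> X"
proof
  fix S assume "S \<in> {S \<in> copies (path_graph 4) (complete_graph n). \<not> rainbow c S}"
  then have S: "S \<in> copies (path_graph 4) (complete_graph n)" "\<not> rainbow c S" by simp_all
  then obtain e f where ef: "e \<in> edges S" "f \<in> edges S" "e \<noteq> f" "c e = c f"
    by (auto simp: rainbow_def inj_on_def)
  with S have "S \<in> copies_through n e f" by (simp add: copies_through_def)
  then show "S \<in> X" using assms[of e f] ef edges_copy[OF S(1)] by blast
qed

text \<open>The converse inclusion, for lower bounds in explicit colorings.\<close>

lemma copies_through_not_rainbow:
  assumes "e \<noteq> f" "c e = c f"
  shows "copies_through n e f \<subseteq> {S \<in> copies (path_graph 4) (complete_graph n). \<not> rainbow c S}"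
  using assms by (auto simp: copies_through_def rainbow_def inj_on_def)

text \<open>Every color other than \<open>i\<close> must occur on an edge outside
  \<open>F\<close>.\<close>

lemma card_monochromatic_le:
  assumes "finite E" "F \<subseteq> E" "\<And>e. e \<in> F \<Longrightarrow> c e = i"
  shows "card F + card (c ` E) \<le> card E + 1"
proof -
  have "c ` E \<subseteq> insert i (c ` (E - F))" using assms(3) by auto
  then have "card (c ` E) \<le> card (insert i (c ` (E - F)))"
    using assms(1) by (intro card_mono) auto
  also have "\<dots> \<le> Suc (card (c ` (E - F)))" by (rule card_insert_le_m1) auto
  also have "card (c ` (E - F)) \<le> card (E - F)" using assms(1) by (intro card_image_le) auto
  also have "card (E - F) = card E - card F"
    using assms by (intro card_Diff_subset) (auto intro: finite_subset)
  finally show ?thesis using card_mono[OF assms(1,2)] by simp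
qed

text \<open>A copy has as many edges as \<open>H\<close>. When the colors are two fewer than the
  edges of \<open>G\<close>, at most three edges can share a color, so the hypothesis then amounts
  to \<open>H\<close> having at least four edges.\<close>

lemma monochromatic_copies_empty:
  assumes "finite_simple_graph H" "finite (edges G)"
    and "card (edges G) + 1 < card (edges H) + card (c ` edges G)"
  shows "monochromatic_copies c H G = {}"
proof (rule ccontr)
  assume "monochromatic_copies c H G \<noteq> {}"
  then obtain S where S: "S \<in> copies H G" "monochromatic c S"
    by (auto simp: monochromatic_copies_def)
  then obtain f where f: "bij_betw f (verts H) (verts S)" "(\<lambda>e. f ` e) ` edges H = edges S"
    by (auto simp: copies_def graph_isomorphic_def)
  from S(2) obtain i where i: "\<And>e. e \<in> edges S \<Longrightarrow> c e = i"
    by (auto simp: monochromatic_def)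
  have "inj_on (\<lambda>e. f ` e) (edges H)"
    using f(1) assms(1) by (intro inj_on_subset[OF inj_on_image_Pow])
      (auto simp: bij_betw_def finite_simple_graph_def)
  then have "card (edges S) = card (edges H)"
    using f(2) card_image by fastforce
  moreover have "card (edges S) + card (c ` edges G) \<le> card (edges G) + 1"
    using card_monochromatic_le[OF assms(2) edges_copy[OF S(1)] i] .
  ultimately show False using assms(3) by simp
qed

text \<open>One representative edge per color, collected in \<open>R\<close>, leaves exactly two
  further edges. If these agree in color, they and their representative form a class of three;
  otherwise each forms a class of two with its own representative. All other colors occur
  once.\<close>

lemma two_repeated_colors:
  assumes "finite E" "card E = card (c ` E) + 2"
  obtains (triple) e f g where "{e, f, g} \<subseteq> E" "distinct [e, f, g]"
      "\<And>x y. x \<in> E \<Longrightarrow> y \<in> E \<Longrightarrow> x \<noteq> y \<Longrightarrow> c x = c y \<Longrightarrow> {x, y} \<subseteq> {e, f, g}"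
  | (pairs) e e' f f' where "{e, e', f, f'} \<subseteq> E" "distinct [e, e', f, f']"
      "\<And>x y. x \<in> E \<Longrightarrow> y \<in> E \<Longrightarrow> x \<noteq> y \<Longrightarrow> c x = c y \<Longrightarrow> {x, y} = {e, e'} \<or> {x, y} = {f, f'}"
proof -
  obtain R where R: "R \<subseteq> E" "inj_on c R" "c ` E = c ` R"
    using subset_image_inj[of "c ` E" c E] by auto
  have "card (E - R) = 2"
    using R assms finite_subset[OF R(1)] by (simp add: card_Diff_subset card_image)
  then obtain e f where ef: "E - R = {e, f}" "e \<noteq> f" by (auto simp: card_2_iff)
  then have E: "E = insert e (insert f R)" using R(1) by auto
  have "e \<in> E" "f \<in> E" using ef by auto
  then have "c e \<in> c ` R" "c f \<in> c ` R" using R(3) by auto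
  then obtain e' f' where e': "e' \<in> R" "c e' = c e" and f': "f' \<in> R" "c f' = c f"
    by (metis imageE)
  have nR: "e \<notin> R" "f \<notin> R" using ef by auto
  have inj: "x = y" if "x \<in> R" "y \<in> R" "c x = c y" for x y
    using R(2) that by (auto dest: inj_onD)
  show thesis
  proof (cases "c e = c f")
    case True
    have "{e, f, e'} \<subseteq> E" "distinct [e, f, e']" using ef e' nR R(1) by auto
    moreover have "{x, y} \<subseteq> {e, f, e'}" if "x \<in> E" "y \<in> E" "x \<noteq> y" "c x = c y" for x y
      using that inj e' True unfolding E by (metis empty_subsetI insert_iff insert_subset)
    ultimately show thesis by (rule triple)
  next
    case False
    have "{e, e', f, f'} \<subseteq> E" "distinct [e, e', f, f']"
      using ef e' f' nR R(1) False by auto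
    moreover have "{x, y} = {e, e'} \<or> {x, y} = {f, f'}"
      if "x \<in> E" "y \<in> E" "x \<noteq> y" "c x = c y" for x y
      using that inj e' f' False unfolding E by (metis insert_commute insert_iff)
    ultimately show thesis by (rule pairs)
  qed
qed

section \<open>Upper bound for the number of non-rainbow copies\<close>

lemma card_copies_through_le:
  assumes "e \<in> edges (complete_graph n)" "f \<in> edges (complete_graph n)" "e \<noteq> f"
  shows "card (copies_through n e f) \<le> max 4 (2 * (n - 3))"
  using card_copies_through_meet[OF assms] card_copies_through_disjnt[OF assms(1,2)]
  by (cases "e \<inter> f = {}") auto

text \<open>An edge of \<open>K_4\<close> disjoint from \<open>e\<close> is the complement of
  \<open>e\<close> in the vertex set.\<close>

lemma edges_K4_disjoint_unique:
  assumes "{e, f, g} \<subseteq> edges (complete_graph 4)" "e \<inter> f = {}" "e \<inter> g = {}"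
  shows "f = g"
proof -
  have "{..<4} - e = h" if "h \<in> {f, g}" for h
  proof (rule card_subset_eq[symmetric])
    show "h \<subseteq> {..<4} - e" using that assms by (auto simp: edges_complete_graph)
    have "finite e" using assms(1) by (auto simp: edges_complete_graph intro: finite_subset)
    then show "card h = card ({..<4 :: nat} - e)"
      using that assms(1) by (auto simp: edges_complete_graph card_Diff_subset)
  qed simp
  then show ?thesis by blast
qed

text \<open>At most one of the three pairs is disjoint, which gives at most
  \<open>4 + 2 + 2\<close>; the bound of \<open>4\<close> for every pair would only give
  \<open>12\<close>.\<close>

lemma card_copies_through_triple_K4:
  assumes "{e, f, g} \<subseteq> edges (complete_graph 4)" "distinct [e, f, g]"
  shows "card (copies_through 4 e f) + card (copies_through 4 f g) + card (copies_through 4 e g) \<le> 8"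
proof -
  let ?N = "\<lambda>e f. card (copies_through 4 e f)"
  have N: "?N e f = (if e \<inter> f = {} then 4 else 2)" "?N f g = (if f \<inter> g = {} then 4 else 2)"
    "?N e g = (if e \<inter> g = {} then 4 else 2)"
    using assms by (simp_all add: card_copies_through_meet card_copies_through_disjnt)
  have "\<not> (e \<inter> f = {} \<and> e \<inter> g = {})" "\<not> (f \<inter> e = {} \<and> f \<inter> g = {})" "\<not> (g \<inter> e = {} \<and> g \<inter> f = {})"
    using edges_K4_disjoint_unique[of e f g] edges_K4_disjoint_unique[of f e g]
      edges_K4_disjoint_unique[of g e f] assms by auto
  then show ?thesis unfolding N by (auto simp: Int_commute)
qed

text \<open>A union bound over the pairs of equal color: three pairs if one class has three edges,
  two pairs if two classes have two edges each.\<close>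

lemma card_not_rainbow_le:
  assumes "card (edges (complete_graph n)) = card (c ` edges (complete_graph n)) + 2" "4 \<le> n"
  shows "card {S \<in> copies (path_graph 4) (complete_graph n). \<not> rainbow c S} \<le>
    (if n = 4 then 8 else 6 * (n - 3))" (is "card ?X \<le> _")
proof -
  let ?E = "edges (complete_graph n)"
  let ?T = "copies_through n"
  from finite_edges_complete_graph assms(1) show ?thesis
  proof (cases rule: two_repeated_colors)
    case (triple e f g)
    have "?T x y \<subseteq> ?T e f \<union> ?T f g \<union> ?T e g"
      if "x \<in> ?E" "y \<in> ?E" "x \<noteq> y" "c x = c y" for x y
      using triple(3)[OF that] that(3) by (auto simp: copies_through_def)
    then have "?X \<subseteq> ?T e f \<union> ?T f g \<union> ?T e g"
      by (rule not_rainbow_subset)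
    then have "card ?X \<le> card (?T e f \<union> ?T f g \<union> ?T e g)"
      by (intro card_mono) (auto simp: finite_copies_through)
    also have "\<dots> \<le> card (?T e f) + card (?T f g) + card (?T e g)"
      by (meson add_le_mono card_Un_le order.refl order.trans)
    also have "\<dots> \<le> (if n = 4 then 8 else 6 * (n - 3))"
    proof (cases "n = 4")
      case True
      then show ?thesis using card_copies_through_triple_K4 triple(1,2) by simp
    next
      case False
      \<comment> \<open>For \<open>n\<close> at least \<open>5\<close> the maximum of
        \<open>4\<close> and \<open>2 * (n - 3)\<close> is the latter.\<close>
      then show ?thesis
        using card_copies_through_le[of e n f] card_copies_through_le[of f n g]
          card_copies_through_le[of e n g] triple(1,2) assms(2) by auto
    qed
    finally show ?thesis .
  next
    case (pairs e e' f f')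
    have "?T x y \<subseteq> ?T e e' \<union> ?T f f'"
      if "x \<in> ?E" "y \<in> ?E" "x \<noteq> y" "c x = c y" for x y
      using pairs(3)[OF that] by (auto simp: copies_through_def doubleton_eq_iff)
    then have "?X \<subseteq> ?T e e' \<union> ?T f f'"
      by (rule not_rainbow_subset)
    then have "card ?X \<le> card (?T e e' \<union> ?T f f')"
      by (intro card_mono) (auto simp: finite_copies_through)
    also have "\<dots> \<le> card (?T e e') + card (?T f f')" by (rule card_Un_le)
    also have "\<dots> \<le> (if n = 4 then 8 else 6 * (n - 3))"
    proof -
      have "card (?T e e') \<le> max 4 (2 * (n - 3))" "card (?T f f') \<le> max 4 (2 * (n - 3))"
        using pairs(1,2) by (simp_all add: card_copies_through_le)
      \<comment> \<open>For \<open>n = 4\<close> both terms are at most \<open>4\<close>; otherwise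
        the sum is at most \<open>4 * (n - 3)\<close>.\<close>
      then show ?thesis using assms(2) by (cases "n = 4") (auto simp: max_def split: if_splits)
    qed
    finally show ?thesis .
  qed
qed

section \<open>Colorings that attain the bound\<close>

lemma ex_coloring_K4:
  "\<exists>c. exact_edge_coloring (complete_graph 4) 4 c \<and>
    8 \<le> card {S \<in> copies (path_graph 4) (complete_graph 4). \<not> rainbow c S}"
proof -
  \<comment> \<open>Two perfect matchings of \<open>K_4\<close> become color classes, and the two
    edges of the third matching get colors of their own. Each of the two disjoint pairs spoils
    \<open>4\<close> copies.\<close>
  define c :: "nat set \<Rightarrow> nat" where
    "c e = (if e \<in> {{0, 1}, {2, 3}} then 1 else if e \<in> {{0, 2}, {1, 3}} then 2
      else if e = {0, 3} then 3 else 4)" for e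
  let ?K = "complete_graph 4"
  have one_to_four: "{1..4} = {1, 2, 3, 4 :: nat}" by auto
  let ?A = "copies_through 4 {0, 1} {2, 3}" and ?B = "copies_through 4 {0, 2} {1, 3}"
  have ed: "{{0, 1}, {2, 3}, {0, 2}, {1, 3}, {0, 3}, {1, 2}} \<subseteq> edges ?K"
    using edge_complete_graph_iff[of _ _ 4] by auto
  have "c {0, 1} = 1" "c {0, 2} = 2" "c {0, 3} = 3" "c {1, 2} = 4"
    by (simp_all add: c_def doubleton_eq_iff)
  then have "{1, 2, 3, 4} \<subseteq> c ` edges ?K"
    using ed by (auto simp: image_iff) metis+
  moreover have "c ` edges ?K \<subseteq> {1, 2, 3, 4}" by (auto simp: c_def)
  ultimately have "exact_edge_coloring ?K 4 c"
    unfolding exact_edge_coloring_def by (subst one_to_four) (rule equalityI)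
  \<comment> \<open>A common copy would contain both matchings, hence four edges.\<close>
  moreover have "?A \<inter> ?B = {}"
  proof (rule equals0I)
    fix S assume "S \<in> ?A \<inter> ?B"
    then have S: "S \<in> copies (path_graph 4) ?K"
      and sub: "{{0, 1}, {2, 3}, {0, 2}, {1, 3}} \<subseteq> edges S"
      by (auto simp: copies_through_def)
    have "card {{0, 1}, {2, 3}, {0, 2}, {1, 3 :: nat}} \<le> card (edges S)"
      using card_edges_copy_path_4[OF S] by (intro card_mono sub) (simp add: card_ge_0_finite)
    then show False using card_edges_copy_path_4[OF S] by (simp add: doubleton_eq_iff)
  qed
  then have "card (?A \<union> ?B) = 8"
    by (simp add: card_Un_disjoint finite_copies_through card_copies_through_disjoint)
  moreover have "card (?A \<union> ?B) \<le> card {S \<in> copies (path_graph 4) ?K. \<not> rainbow c S}"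
  proof (rule card_mono)
    show "?A \<union> ?B \<subseteq> {S \<in> copies (path_graph 4) ?K. \<not> rainbow c S}"
      by (intro Un_least copies_through_not_rainbow) (simp_all add: c_def doubleton_eq_iff)
  qed (simp add: finite_copies_path_4)
  ultimately show ?thesis by auto
qed

text \<open>A monochromatic triangle contains three adjacent pairs, each lying in
  \<open>2 * (n - 3)\<close> copies. These families are disjoint, since a path contains no
  triangle.\<close>

lemma ex_coloring_mono_triangle:
  assumes "3 \<le> n"
  shows "\<exists>c. exact_edge_coloring (complete_graph n) ((n choose 2) - 2) c \<and>
    6 * (n - 3) \<le> card {S \<in> copies (path_graph 4) (complete_graph n). \<not> rainbow c S}"
proof -
  let ?E = "edges (complete_graph n)" and ?k = "(n choose 2) - 2"
  define T :: "nat set set" where "T = {{0, 1}, {1, 2}, {0, 2}}"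
  have T: "T \<subseteq> ?E" "card T = 3" "finite T"
    using assms by (auto simp: T_def edge_complete_graph_iff doubleton_eq_iff)
  then have k: "3 \<le> n choose 2"
    using card_mono[OF finite_edges_complete_graph T(1)] by (simp add: card_edges_complete_graph)
  \<comment> \<open>Color \<open>1\<close> is reserved for the triangle; the other
    \<open>(n choose 2) - 3\<close> edges get the colors from \<open>2\<close> to \<open>?k\<close>
    bijectively.\<close>
  have "card (?E - T) = card {2..?k}"
    using T k by (simp add: card_Diff_subset card_edges_complete_graph)
  then obtain h where h: "bij_betw h (?E - T) {2..?k}"
    using finite_same_card_bij[of "?E - T" "{2..?k}"] finite_edges_complete_graph by auto
  define c where "c e = (if e \<in> T then 1 else h e)" for e
  have "c ` ?E = c ` T \<union> c ` (?E - T)" using T(1) by auto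
  also have "c ` T = {1}" by (auto simp: c_def T_def)
  also have "c ` (?E - T) = {2..?k}" using h by (auto simp: c_def bij_betw_def)
  also have "{1} \<union> {2..?k} = {1..?k}" using k by auto
  finally have "exact_edge_coloring (complete_graph n) ?k c"
    by (simp add: exact_edge_coloring_def)
  moreover
  let ?t = "copies_through n"
  \<comment> \<open>The edges are written with the shared vertex in the middle, to match
    \<open>card_copies_through_adjacent\<close>.\<close>
  let ?A = "?t {0, 1} {1, 2}" and ?B = "?t {1, 2} {2, 0}" and ?C = "?t {1, 0} {0, 2}"
  \<comment> \<open>The triangle would be the whole edge set of the path, but it covers only three
    vertices instead of four.\<close>
  have no_triangle: "\<not> T \<subseteq> edges S" if S: "S \<in> copies (path_graph 4) (complete_graph n)" for S
  proof
    assume "T \<subseteq> edges S"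
    then have "T = edges S"
      using T(2) card_edges_copy_path_4[OF S] by (intro card_subset_eq) (simp_all add: card_ge_0_finite)
    then have "card (\<Union> T) = 4" using card_Union_edges_copy_path_4[OF S] by simp
    moreover have "\<Union> T = {0, 1, 2}" by (auto simp: T_def)
    ultimately show False by simp
  qed
  have "?A \<inter> ?B = {}" "(?A \<union> ?B) \<inter> ?C = {}"
    using no_triangle by (auto simp: copies_through_def T_def insert_commute)
  then have "card (?A \<union> ?B \<union> ?C) = 6 * (n - 3)"
    using assms
    by (simp add: card_Un_disjoint finite_copies_through card_copies_through_adjacent)
  moreover have "card (?A \<union> ?B \<union> ?C) \<le>
    card {S \<in> copies (path_graph 4) (complete_graph n). \<not> rainbow c S}"
  proof (rule card_mono)
    show "?A \<union> ?B \<union> ?C \<subseteq>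
      {S \<in> copies (path_graph 4) (complete_graph n). \<not> rainbow c S}"
      by (intro Un_least copies_through_not_rainbow) (auto simp: c_def T_def doubleton_eq_iff)
  qed (simp add: finite_copies_path_4)
  ultimately show ?thesis by auto
qed

section \<open>The Gallai-Ramsey number\<close>

lemma ex_exact_edge_coloring:
  assumes "finite (edges G)" "1 \<le> m" "m \<le> card (edges G)"
  shows "\<exists>c. exact_edge_coloring G m c"
proof -
  obtain h where h: "bij_betw h (edges G) {1..card (edges G)}"
    using finite_same_card_bij[of "edges G" "{1..card (edges G)}"] assms(1) by auto
  \<comment> \<open>The edges are numbered from \<open>1\<close>, and all numbers above
    \<open>m\<close> are lowered to \<open>m\<close>.\<close>
  have "(\<lambda>e. min m (h e)) ` edges G = min m ` (h ` edges G)"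
    by (simp add: image_image)
  also have "h ` edges G = {1..card (edges G)}" using h by (simp add: bij_betw_def)
  also have "min m ` \<dots> = {1..m}"
  proof
    show "{1..m} \<subseteq> min m ` {1..card (edges G)}"
    proof
      fix i assume "i \<in> {1..m}"
      then have "i = min m i" "i \<in> {1..card (edges G)}" using assms(3) by auto
      then show "i \<in> min m ` {1..card (edges G)}" by (rule image_eqI)
    qed
  qed (use assms(2) in auto)
  finally show ?thesis unfolding exact_edge_coloring_def by blast
qed

text \<open>Without a rainbow path, fix adjacent edges \<open>ab\<close> and \<open>bd\<close> of
  different colors. Paths through \<open>a\<close>, \<open>b\<close>, \<open>d\<close> then force
  every color to occur on the triangle spanned by these vertices, so there are at most
  three.\<close>

lemma ex_rainbow_path_4:
  assumes "4 \<le> card (c ` edges (complete_graph n))"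
  shows "rainbow_copies c (path_graph 4) (complete_graph n) \<noteq> {}"
proof
  assume none: "rainbow_copies c (path_graph 4) (complete_graph n) = {}"
  let ?E = "edges (complete_graph n)"
  define col where "col x y = c {x, y}" for x y
  have sym: "col x y = col y x" for x y by (simp add: col_def insert_commute)
  have P: "col w x = col x y \<or> col x y = col y z \<or> col w x = col y z"
    if "distinct [w, x, y, z]" "w < n" "x < n" "y < n" "z < n" for w x y z
  proof (rule ccontr)
    assume "\<not> ?thesis"
    then have "rainbow c (path_on w x y z)"
      by (auto simp: rainbow_def inj_on_def col_def)
    moreover have "path_on w x y z \<in> copies (path_graph 4) (complete_graph n)"
      unfolding copies_path_4 using that by blast
    ultimately have "path_on w x y z \<in> rainbow_copies c (path_graph 4) (complete_graph n)"
      by (simp add: rainbow_copies_def)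
    then show False using none by simp
  qed
  have few: False if "c ` ?E \<subseteq> {i, j, l}" for i j l
  proof -
    have "card (c ` ?E) \<le> card {i, j, l}" using that by (intro card_mono) auto
    also have "\<dots> \<le> 3" by (simp add: card_insert_if)
    finally show False using assms by simp
  qed
  have edge: "\<exists>x y. e = {x, y} \<and> x \<noteq> y \<and> x < n \<and> y < n" if "e \<in> ?E" for e
    using that by (auto simp: edges_complete_graph card_2_iff)
  \<comment> \<open>If adjacent edges always agreed, any two edges could be linked by adjacent ones,
    and only one color would occur.\<close>
  have "\<exists>a b d. distinct [a, b, d] \<and> a < n \<and> b < n \<and> d < n \<and> col a b \<noteq> col b d"
  proof (rule ccontr)
    assume "\<not> ?thesis"
    then have "\<And>a b d. distinct [a, b, d] \<Longrightarrow> a < n \<Longrightarrow> b < n \<Longrightarrow> d < n \<Longrightarrow> col a b = col b d"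
      by blast
    then have adj: "col a b = col b d" if "a \<noteq> b" "b \<noteq> d" "a < n" "b < n" "d < n" for a b d
      using that sym[of a b] by (cases "a = d") simp_all
    have "?E \<noteq> {}" using assms by auto
    then obtain x y where xy: "x \<noteq> y" "x < n" "y < n" using edge by blast
    have "c e = col x y" if "e \<in> ?E" for e
    proof -
      from edge[OF that] obtain u v where uv: "e = {u, v}" "u \<noteq> v" "u < n" "v < n" by blast
      have "col x y = col u v"
      proof (cases "y = u")
        case True
        then show ?thesis using adj[of x y v] xy uv by simp
      next
        case False
        then show ?thesis using adj[of x y u] adj[of y u v] xy uv by simp
      qed
      then show ?thesis by (simp add: col_def uv)
    qed
    then have "c ` ?E \<subseteq> {col x y, col x y, col x y}" by blast
    then show False by (rule few)
  qed
  then obtain a b d where abd: "distinct [a, b, d]" "a < n" "b < n" "d < n"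
    and ne: "col a b \<noteq> col b d" by blast
  let ?C = "{col a b, col b d, col a d}"
  \<comment> \<open>The paths \<open>z a b d\<close> and \<open>a b d z\<close> contain
    \<open>ab\<close> and \<open>bd\<close>, which differ, so the third edge repeats one of these
    colors.\<close>
  have a_d: "col a z \<in> {col a b, col b d} \<and> col d z \<in> {col a b, col b d}"
    if "z < n" "z \<notin> {a, b, d}" for z
  proof
    show "col a z \<in> {col a b, col b d}"
      using P[of z a b d] that abd ne sym[of z a] by auto
    show "col d z \<in> {col a b, col b d}"
      using P[of a b d z] that abd ne by auto
  qed
  \<comment> \<open>If \<open>xy\<close> had a new color, the paths \<open>b d x y\<close> and
    \<open>b a x y\<close> would give \<open>dx\<close> the color of \<open>bd\<close> and
    \<open>ax\<close> that of \<open>ab\<close>. The paths \<open>y x b a\<close> and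
    \<open>y x b d\<close> would give \<open>xb\<close> the new color, making \<open>a x b d\<close>
    rainbow.\<close>
  have outer: "col x y \<in> {col a b, col b d}"
    if z: "x < n" "x \<notin> {a, b, d}" "y < n" "y \<notin> {a, b, d}" "x \<noteq> y" for x y
  proof (rule ccontr)
    assume new: "\<not> ?thesis"
    have "col d x = col b d" using P[of b d x y] a_d[of x] z abd new by auto
    moreover have "col a x = col a b" using P[of b a x y] a_d[of x] z abd new sym[of a b] by auto
    moreover have "col x b = col x y"
      using P[of y x b a] P[of y x b d] z abd new ne sym[of x y] sym[of a b] by auto
    ultimately show False using P[of a x b d] z abd new ne by auto
  qed
  \<comment> \<open>If \<open>bz\<close> had a new color, the paths \<open>d a b z\<close> and
    \<open>a d b z\<close> would give \<open>ad\<close> the colors of both \<open>ab\<close> and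
    \<open>bd\<close>.\<close>
  have star: "col b z \<in> ?C" if z: "z < n" "z \<notin> {a, b, d}" for z
  proof (rule ccontr)
    assume new: "\<not> ?thesis"
    have "col d a = col a b \<or> col a b = col b z \<or> col d a = col b z"
      by (rule P) (use z abd in auto)
    then have "col a d = col a b" using new sym[of d a] by simp
    moreover have "col a d = col d b \<or> col d b = col b z \<or> col a d = col b z"
      by (rule P) (use z abd in auto)
    then have "col a d = col b d" using new sym[of d b] by simp
    ultimately show False using ne by simp
  qed
  have "c e \<in> ?C" if "e \<in> ?E" for e
  proof -
    from edge[OF that] obtain x y where xy: "e = {x, y}" "x \<noteq> y" "x < n" "y < n" by blast
    \<comment> \<open>This settles the edges with at least one end outside the triangle.\<close>
    have half: "col x y \<in> ?C" if "x \<noteq> y" "x < n" "y < n" "y \<notin> {a, b, d}" for x y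
      using a_d[of y] star[of y] outer[of x y] that by (cases "x \<in> {a, b, d}") auto
    have "col x y \<in> ?C"
    proof (cases "x \<in> {a, b, d} \<and> y \<in> {a, b, d}")
      case True
      then show ?thesis using xy(2) sym[of a b] sym[of b d] sym[of a d] by auto
    next
      case False
      then show ?thesis using half[of x y] half[of y x] xy sym[of x y] by auto
    qed
    then show ?thesis by (simp add: col_def xy)
  qed
  then have "c ` ?E \<subseteq> ?C" by blast
  then show False by (rule few)
qed

text \<open>From \<open>t\<close> on there are enough edges for an exact coloring, and four colors
  force a rainbow path. \<open>K_(t-1)\<close> has \<open>t - 1 \<ge> 3\<close> edges fewer than
  \<open>K_t\<close>, too few for \<open>(t choose 2) - 2\<close> colors.\<close>

lemma gallai_ramsey_path_4:
  fixes H :: "'a graph"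
  assumes "4 \<le> t"
  shows "gallai_ramsey ((t choose 2) - 2) (path_graph 4) H = t"
  unfolding gallai_ramsey_def
proof (rule Least_equality)
  let ?m = "(t choose 2) - 2"
  have t: "t choose 2 = (t - 1 choose 2) + (t - 1)"
    using assms by (cases t) (auto simp: numeral_2_eq_2)
  have "4 choose 2 \<le> t choose 2" using assms by (rule binomial_right_mono)
  then have m: "4 \<le> ?m" by (simp add: choose_two)
  show "\<forall>n\<ge>t. (\<exists>c. exact_edge_coloring (complete_graph n) ?m c) \<and>
    (\<forall>c. exact_edge_coloring (complete_graph n) ?m c \<longrightarrow>
      rainbow_copies c (path_graph 4) (complete_graph n) \<noteq> {} \<or>
      monochromatic_copies c H (complete_graph n) \<noteq> {})"
  proof (intro allI impI conjI)
    fix n assume "t \<le> n"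
    then have "?m \<le> card (edges (complete_graph n))"
      using binomial_right_mono[of t n 2] by (simp add: card_edges_complete_graph)
    then show "\<exists>c. exact_edge_coloring (complete_graph n) ?m c"
      using m finite_edges_complete_graph by (intro ex_exact_edge_coloring) auto
  next
    fix n c assume "exact_edge_coloring (complete_graph n) ?m c"
    then have "4 \<le> card (c ` edges (complete_graph n))"
      using m by (simp add: exact_edge_coloring_def)
    then show "rainbow_copies c (path_graph 4) (complete_graph n) \<noteq> {} \<or>
      monochromatic_copies c H (complete_graph n) \<noteq> {}"
      using ex_rainbow_path_4 by blast
  qed
  fix N assume N: "\<forall>n\<ge>N. (\<exists>c. exact_edge_coloring (complete_graph n) ?m c) \<and>
    (\<forall>c. exact_edge_coloring (complete_graph n) ?m c \<longrightarrow>
      rainbow_copies c (path_graph 4) (complete_graph n) \<noteq> {} \<or>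
      monochromatic_copies c H (complete_graph n) \<noteq> {})"
  show "t \<le> N"
  proof (rule ccontr)
    assume "\<not> t \<le> N"
    then have "N \<le> t - 1" by simp
    \<comment> \<open>The lower bound comes from the existence clause of the definition, read at
      \<open>n = t - 1\<close>.\<close>
    then obtain c where "exact_edge_coloring (complete_graph (t - 1)) ?m c" using N by blast
    then have "card (c ` edges (complete_graph (t - 1))) = ?m"
      by (simp add: exact_edge_coloring_def)
    then have "?m \<le> t - 1 choose 2"
      using card_image_le[OF finite_edges_complete_graph, of c "t - 1"]
      by (simp add: card_edges_complete_graph)
    then show False using t assms by simp
  qed
qed

theorem theorem3p7:
  fixes H :: "'a graph" and k t :: nat
  assumes "finite_simple_graph H" and "no_isolated_vertices H"
    and "card (edges H) \<ge> 4"
    and "k = t choose 2" and "k \<ge> 6"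
  shows "int (gallai_ramsey_multiplicity (k - 2) (path_graph 4) H) =
    (if t = 4 then 4 else 12 * int (t choose 4) - 6 * (int t - 3))"
proof -
  let ?K = "complete_graph t"
  let ?bad = "\<lambda>c. {S \<in> copies (path_graph 4) ?K. \<not> rainbow c S}"
  \<comment> \<open>The largest possible number of non-rainbow copies; the minimum sought is the
    number of all copies less \<open>b\<close>.\<close>
  define b where "b = (if t = 4 then 8 else 6 * (t - 3))"
  have t: "4 \<le> t"
  proof (rule ccontr)
    assume "\<not> 4 \<le> t"
    then have "t choose 2 \<le> 3 choose 2" by (intro binomial_right_mono) simp
    then show False using assms(4,5) by (simp add: choose_two)
  qed
  have total: "card (rainbow_copies c (path_graph 4) ?K) + card (monochromatic_copies c H ?K) =
      12 * (t choose 4) - card (?bad c)" and bad: "card (?bad c) \<le> b"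
    if "exact_edge_coloring ?K (k - 2) c" for c
  proof -
    have colors: "card (edges ?K) = card (c ` edges ?K) + 2"
      using that assms(4,5) by (simp add: exact_edge_coloring_def card_edges_complete_graph)
    then have "monochromatic_copies c H ?K = {}"
      using assms(1,3) by (intro monochromatic_copies_empty) (auto simp: finite_edges_complete_graph)
    then show "card (rainbow_copies c (path_graph 4) ?K) + card (monochromatic_copies c H ?K) =
      12 * (t choose 4) - card (?bad c)"
      by (simp add: card_rainbow_path_4)
    show "card (?bad c) \<le> b"
      using card_not_rainbow_le[OF colors t] by (simp add: b_def)
  qed
  have "\<exists>c. exact_edge_coloring ?K (k - 2) c \<and> b \<le> card (?bad c)"
  proof (cases "t = 4")
    case True
    moreover from this have "k - 2 = 4" using assms(4) by (simp add: choose_two)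
    ultimately show ?thesis using ex_coloring_K4 by (simp add: b_def)
  next
    case False
    then show ?thesis using ex_coloring_mono_triangle[of t] t assms(4) by (simp add: b_def)
  qed
  then obtain c where c: "exact_edge_coloring ?K (k - 2) c" "card (?bad c) = b"
    using bad by (meson le_antisym)
  \<comment> \<open>This makes the natural-number subtraction of \<open>b\<close> exact, so that it
    carries over to the integers.\<close>
  have "card (?bad c) \<le> 12 * (t choose 4)"
    unfolding card_copies_path_4[symmetric]
    by (intro card_mono finite_copies_path_4) auto
  then have b: "b \<le> 12 * (t choose 4)" using c(2) by simp
  have "gallai_ramsey_multiplicity (k - 2) (path_graph 4) H = 12 * (t choose 4) - b"
    unfolding gallai_ramsey_multiplicity_def assms(4) gallai_ramsey_path_4[OF t] Let_def
  proof (rule Least_equality)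
    show "\<exists>c. exact_edge_coloring ?K ((t choose 2) - 2) c \<and> 12 * (t choose 4) - b =
        card (rainbow_copies c (path_graph 4) ?K) + card (monochromatic_copies c H ?K)"
      using c total[OF c(1)] assms(4) by auto
  next
    fix m assume "\<exists>c. exact_edge_coloring ?K ((t choose 2) - 2) c \<and> m =
        card (rainbow_copies c (path_graph 4) ?K) + card (monochromatic_copies c H ?K)"
    then obtain c' where c': "exact_edge_coloring ?K (k - 2) c'" and m: "m =
        card (rainbow_copies c' (path_graph 4) ?K) + card (monochromatic_copies c' H ?K)"
      using assms(4) by blast
    show "12 * (t choose 4) - b \<le> m"
      unfolding m total[OF c'] using bad[OF c'] by (rule diff_le_mono2)
  qed
  then have "int (gallai_ramsey_multiplicity (k - 2) (path_graph 4) H) = 12 * int (t choose 4) - int b"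
    using b by (simp add: of_nat_diff)
  also have "\<dots> = (if t = 4 then 4 else 12 * int (t choose 4) - 6 * (int t - 3))"
    using t by (simp add: b_def of_nat_diff)
  finally show ?thesis .
qed

end
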